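(* Let $G$ be a graph of order $n$ with distinguishing number $D(G) = d$. Then $\rho_d(G) \leq n - \mathrm{Det}(G)$.
   Context: Graphs are finite and simple; the order of a graph is its number of vertices. For a graph $G$ with vertex set $V(G)$, a labeling $\phi : V(G) \to \{1,\ldots,r\}$ is $r$-distinguishing if for every non-trivial automorphism $\sigma \in \mathrm{Aut}(G)$ there is a vertex $x$ with $\phi(x) \neq \phi(\sigma x)$. The distinguishing number $D(G)$ is the least positive integer $r$ such that $G$ has an $r$-distinguishing labeling. If $D(G) = d$, the cost of $d$-distinguishing $G$, denoted $\rho_d(G)$, is the minimum size of a label class in any $d$-distinguishing labeling of $G$ (minimum over all such labelings and all $d$ label classes). A subset $S \subseteq V(G)$ is a determining set for $G$ if whenever $g,h \in \mathrm{Aut}(G)$ satisfy $g(s) = h(s)$ for all $s \in S$, then $g = h$. The determining number $\mathrm{Det}(G)$ is the minimum cardinality of a determining set of $G$. *)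

theory Defs
  imports "Graph_Theory.Digraph" "HOL-Combinatorics.Permutations" "HOL-Library.FuncSet"
begin

text \<open>
  A finite simple graph is a symmetric digraph without loops and parallel arcs
  (locale \<^locale>\<open>graph\<close>); \<^term>\<open>u \<rightarrow>\<^bsub>G\<^esub> v\<close> is its adjacency relation.
\<close>

text \<open>
  Because \<^const>\<open>permutes\<close> forces an automorphism to be the identity outside of the
  vertex set, two automorphisms are equal as functions iff they agree on all vertices;
  in particular the trivial automorphism is exactly \<^const>\<open>id\<close>.
\<close>

definition Aut :: "('a, 'b) pre_digraph \<Rightarrow> ('a \<Rightarrow> 'a) set" where
  "Aut G = {\<sigma>. \<sigma> permutes verts G \<and>
     (\<forall>u \<in> verts G. \<forall>v \<in> verts G. u \<rightarrow>\<^bsub>G\<^esub> v \<longleftrightarrow> \<sigma> u \<rightarrow>\<^bsub>G\<^esub> \<sigma> v)}"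

definition distinguishing :: "('a, 'b) pre_digraph \<Rightarrow> nat \<Rightarrow> ('a \<Rightarrow> nat) \<Rightarrow> bool" where
  "distinguishing G r \<phi> \<longleftrightarrow> \<phi> \<in> verts G \<rightarrow> {1..r} \<and>
     (\<forall>\<sigma> \<in> Aut G. \<sigma> \<noteq> id \<longrightarrow> (\<exists>x \<in> verts G. \<phi> x \<noteq> \<phi> (\<sigma> x)))"

definition distinguishing_number :: "('a, 'b) pre_digraph \<Rightarrow> nat" where
  "distinguishing_number G = (LEAST r. 1 \<le> r \<and> (\<exists>\<phi>. distinguishing G r \<phi>))"

definition label_class :: "('a, 'b) pre_digraph \<Rightarrow> ('a \<Rightarrow> nat) \<Rightarrow> nat \<Rightarrow> 'a set" where
  "label_class G \<phi> i = {x \<in> verts G. \<phi> x = i}"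

text \<open>
  The cost is only meaningful when \<open>d\<close> is the distinguishing number of \<open>G\<close>. In that case
  no label class is empty unless \<open>G\<close> has no vertices, as an unused label could be
  dropped.
\<close>

definition distinguishing_cost :: "nat \<Rightarrow> ('a, 'b) pre_digraph \<Rightarrow> nat" where
  "distinguishing_cost d G =
     (LEAST k. \<exists>\<phi>. \<exists>i \<in> {1..d}. distinguishing G d \<phi> \<and> k = card (label_class G \<phi> i))"

definition determining_set :: "('a, 'b) pre_digraph \<Rightarrow> 'a set \<Rightarrow> bool" where
  "determining_set G S \<longleftrightarrow> S \<subseteq> verts G \<and>
     (\<forall>g \<in> Aut G. \<forall>h \<in> Aut G. (\<forall>s \<in> S. g s = h s) \<longrightarrow> g = h)"

definition determining_number :: "('a, 'b) pre_digraph \<Rightarrow> nat" where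
  "determining_number G = (LEAST k. \<exists>S. determining_set G S \<and> card S = k)"

end

theory Submission
  imports Defs
begin

text \<open>
  The complement of any label class \<open>C\<close> of any distinguishing labeling is a determining
  set. An automorphism that fixes every vertex outside \<open>C\<close> must map \<open>C\<close> onto itself, since
  it is a bijection; as \<open>C\<close> carries a single label, the automorphism preserves all
  labels and is therefore trivial. Two automorphisms \<open>g\<close> and \<open>h\<close> that agree outside \<open>C\<close>
  reduce to this case through \<open>h\<inverse> \<circ> g\<close>. Hence
  \<open>Det(G) \<le> n - \<bar>C\<bar>\<close> for every label class, and the cost is at most \<open>\<bar>C\<bar>\<close> for
  each class of a labeling that uses \<open>D(G)\<close> labels. The least numbers involved are
  attained because labeling the vertices injectively is distinguishing.
\<close>

lemma Aut_permutes: "\<sigma> \<in> Aut G \<Longrightarrow> \<sigma> permutes verts G"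
  by (simp add: Aut_def)

lemma Aut_inv_comp:
  assumes g: "g \<in> Aut G" and h: "h \<in> Aut G"
  shows "inv h \<circ> g \<in> Aut G"
proof -
  note pg = Aut_permutes[OF g] and ph = Aut_permutes[OF h]
  note pih = permutes_inv[OF ph]
  have "u \<rightarrow>\<^bsub>G\<^esub> v \<longleftrightarrow> inv h (g u) \<rightarrow>\<^bsub>G\<^esub> inv h (g v)"
    if u: "u \<in> verts G" and v: "v \<in> verts G" for u v
  proof -
    have "inv h (g u) \<in> verts G" "inv h (g v) \<in> verts G"
      using u v permutes_in_image[OF pg] permutes_in_image[OF pih] by auto
    then have "inv h (g u) \<rightarrow>\<^bsub>G\<^esub> inv h (g v) \<longleftrightarrow> h (inv h (g u)) \<rightarrow>\<^bsub>G\<^esub> h (inv h (g v))"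
      using h by (auto simp: Aut_def)
    also have "\<dots> \<longleftrightarrow> g u \<rightarrow>\<^bsub>G\<^esub> g v"
      by (simp add: permutes_inverses(1)[OF ph])
    also have "\<dots> \<longleftrightarrow> u \<rightarrow>\<^bsub>G\<^esub> v"
      using g u v by (auto simp: Aut_def)
    finally show ?thesis by simp
  qed
  then show ?thesis
    using permutes_compose[OF pg pih] by (simp add: Aut_def)
qed

lemma distinguishing_complement_label_class_determining:
  assumes \<phi>: "distinguishing G r \<phi>"
  shows "determining_set G (verts G - label_class G \<phi> i)"
  unfolding determining_set_def
proof (intro conjI ballI impI)
  fix g h assume g: "g \<in> Aut G" and h: "h \<in> Aut G"
    and agree: "\<forall>s \<in> verts G - label_class G \<phi> i. g s = h s"
  note ph = Aut_permutes[OF h]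
  define \<sigma> where "\<sigma> = inv h \<circ> g"
  have \<sigma>: "\<sigma> \<in> Aut G"
    unfolding \<sigma>_def by (rule Aut_inv_comp[OF g h])
  note p\<sigma> = Aut_permutes[OF \<sigma>]
  have fixed: "\<sigma> s = s" if "s \<in> verts G" "\<phi> s \<noteq> i" for s
    using agree that permutes_inverses(2)[OF ph]
    by (simp add: \<sigma>_def label_class_def)
  have "\<phi> x = \<phi> (\<sigma> x)" if x: "x \<in> verts G" for x
  proof (cases "\<phi> x = i")
    case True
    have "\<phi> (\<sigma> x) = i"
    proof (rule ccontr)
      assume neq: "\<phi> (\<sigma> x) \<noteq> i"
      \<comment> \<open>Then \<open>\<sigma> x\<close> is a fixed point, so injectivity makes \<open>x\<close> one too.\<close>
      then have "\<sigma> (\<sigma> x) = \<sigma> x"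
        using fixed x permutes_in_image[OF p\<sigma>] by blast
      then have "\<sigma> x = x"
        using permutes_inj[OF p\<sigma>] by (auto dest: injD)
      with True neq show False by simp
    qed
    with True show ?thesis by simp
  qed (simp add: fixed x)
  then have "\<sigma> = id"
    using \<phi> \<sigma> unfolding distinguishing_def by blast
  show "g = h"
  proof
    fix x
    have "g x = h (\<sigma> x)"
      by (simp add: \<sigma>_def permutes_inverses(1)[OF ph])
    then show "g x = h x"
      using \<open>\<sigma> = id\<close> by simp
  qed
qed auto

lemma inj_on_distinguishing:
  assumes \<phi>: "\<phi> \<in> verts G \<rightarrow> {1..r}" and inj: "inj_on \<phi> (verts G)"
  shows "distinguishing G r \<phi>"
  unfolding distinguishing_def
proof (intro conjI ballI impI \<phi>)
  fix \<sigma> assume "\<sigma> \<in> Aut G" and ne: "\<sigma> \<noteq> id"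
  then have p: "\<sigma> permutes verts G" by (simp add: Aut_permutes)
  from ne obtain x where x: "\<sigma> x \<noteq> x" by (auto simp: fun_eq_iff)
  then have "x \<in> verts G" using permutes_not_in[OF p] by blast
  moreover from this have "\<sigma> x \<in> verts G" using permutes_in_image[OF p] by blast
  ultimately show "\<exists>x \<in> verts G. \<phi> x \<noteq> \<phi> (\<sigma> x)"
    using x inj by (metis inj_onD)
qed

text \<open>
  The least number in the definition of the distinguishing number is a genuine minimum, not
  an unspecified value.
\<close>

lemma distinguishing_number_attained:
  assumes "finite (verts G)"
  obtains \<phi> where "1 \<le> distinguishing_number G" "distinguishing G (distinguishing_number G) \<phi>"
proof -
  obtain f where f: "bij_betw f (verts G) {0..<card (verts G)}"
    using ex_bij_betw_finite_nat[OF assms] by blast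
  \<comment> \<open>One label more than there are vertices, so that at least one label is available even
    for the graph without vertices.\<close>
  have "distinguishing G (Suc (card (verts G))) (Suc \<circ> f)"
  proof (rule inj_on_distinguishing)
    show "Suc \<circ> f \<in> verts G \<rightarrow> {1..Suc (card (verts G))}"
      using bij_betwE[OF f] by fastforce
    show "inj_on (Suc \<circ> f) (verts G)"
      using bij_betw_imp_inj_on[OF f] by (simp add: comp_inj_on)
  qed
  then have "\<exists>r. 1 \<le> r \<and> (\<exists>\<phi>. distinguishing G r \<phi>)"
    by (intro exI[of _ "Suc (card (verts G))"]) auto
  from LeastI_ex[OF this] that show thesis
    unfolding distinguishing_number_def by blast
qed

theorem proposition2p5:
  fixes G :: "('a, 'b) pre_digraph" and n d :: nat
  assumes "graph G"
    and "card (verts G) = n"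
    and "distinguishing_number G = d"
  shows "int (distinguishing_cost d G) \<le> int n - int (determining_number G)"
proof -
  interpret graph G by fact
  obtain \<phi> where d: "1 \<le> d" and \<phi>: "distinguishing G d \<phi>"
    using distinguishing_number_attained[OF finite_verts] assms(3) by metis
  \<comment> \<open>Every label class gives the bound; label 1 exists for every \<open>d\<close>.\<close>
  let ?C = "label_class G \<phi> 1"
  have C: "?C \<subseteq> verts G" by (auto simp: label_class_def)
  have cost: "distinguishing_cost d G \<le> card ?C"
    unfolding distinguishing_cost_def
    by (rule Least_le, intro exI[of _ \<phi>] bexI[of _ 1]) (use d \<phi> in auto)
  have "determining_number G \<le> card (verts G - ?C)"
    unfolding determining_number_def
    by (rule Least_le)
      (use distinguishing_complement_label_class_determining[OF \<phi>] in blast)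
  also have "\<dots> = n - card ?C"
    using C assms(2) by (simp add: card_Diff_subset finite_subset)
  finally have "determining_number G \<le> n - card ?C" .
  moreover have "card ?C \<le> n"
    using C assms(2) card_mono[OF finite_verts] by blast
  ultimately show ?thesis
    using cost by linarith
qed

end
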